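(* Let $X$ and $Y$ be finite $T_0$-spaces and let $f\colon X\to Y$ be a homotopy equivalence. Then $\mathcal{U}(f)\colon\mathcal{U}(X)\to\mathcal{U}(Y)$ and $\mathcal{F}(f)\colon\mathcal{F}(X)\to\mathcal{F}(Y)$ are homotopy equivalences. If, in addition, $\mathcal{U}(X)\cap\mathcal{F}(X)=\varnothing$ and $\mathcal{U}(Y)\cap\mathcal{F}(Y)=\varnothing$, then $\mathcal{C}(f)\colon\mathcal{C}(X)\to\mathcal{C}(Y)$ is a homotopy equivalence.
   Context: A finite $T_0$-space is identified with a finite poset: $x\le y$ iff $U_x\subseteq U_y$, where $U_x=\{z\mid z\le x\}$ is the minimal open set containing $x$; $F_x=\{z\mid z\ge x\}$ is the smallest closed set containing $x$. Open sets are the down-sets, and continuous maps are the order-preserving maps. $\mathrm{mxl}(X)$ and $\mathrm{mnl}(X)$ are the sets of maximal and minimal elements of $X$. For a non-empty subset $A\subseteq X$ let $U_A=\bigcap_{a\in A}U_a$ and $F_A=\bigcap_{a\in A}F_a$. $\mathcal{U}(X)$ is the set of all connected components of the non-empty sets $U_A$ with $\varnothing\ne A\subseteq \mathrm{mxl}(X)$; $\mathcal{F}(X)$ is the set of all connected components of the non-empty sets $F_A$ with $\varnothing\neq A\subseteq\mathrm{mnl}(X)$. $\mathcal{U}(X)$ is the poset (finite $T_0$-space) ordered by $\subseteq$, and $\mathcal{F}(X)$ is the poset ordered by $\supseteq$ (that is, $C_1\le C_2$ iff $C_1\supseteq C_2$). $\mathcal{C}(X)$ is the poset with underlying set $\mathcal{U}(X)\cup\mathcal{F}(X)$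 where $C_1\le C_2$ iff one of the following holds: $C_1,C_2\in\mathcal{U}(X)$ and $C_1\subseteq C_2$; $C_1,C_2\in\mathcal{F}(X)$ and $C_1\supseteq C_2$; $C_1\in\mathcal{F}(X)$, $C_2\in\mathcal{U}(X)$ and $C_1\cap C_2\ne\varnothing$. For a continuous map $f\colon X\to Y$: $\mathcal{U}(f)(C)=\min\{D\in\mathcal{U}(Y)\mid f(C)\subseteq D\}$ for $C\in\mathcal{U}(X)$ (minimum in the poset $\mathcal{U}(Y)$), and $\mathcal{F}(f)(C)=\max\{D\in\mathcal{F}(Y)\mid f(C)\subseteq D\}$ for $C\in\mathcal{F}(X)$ (maximum in the poset $\mathcal{F}(Y)$, i.e. the smallest such $D$ for inclusion); these exist and define continuous maps. If $\mathcal{U}(X)\cap\mathcal{F}(X)=\varnothing$, $\mathcal{C}(f)\colon\mathcal{C}(X)\to\mathcal{C}(Y)$ is the (continuous) map equal to $\mathcal{U}(f)$ on $\mathcal{U}(X)$ and to $\mathcal{F}(f)$ on $\mathcal{F}(X)$. *)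

theory Defs
  imports "HOL-Analysis.Analysis"
begin

definition finite_t0_space :: "'a topology \<Rightarrow> bool" where
  "finite_t0_space X \<longleftrightarrow> finite (topspace X) \<and> t0_space X"

text \<open>The map version of \<open>homotopy_equivalent_space\<close>.\<close>

definition homotopy_equivalence_map ::
    "'a topology \<Rightarrow> 'b topology \<Rightarrow> ('a \<Rightarrow> 'b) \<Rightarrow> bool" where
  "homotopy_equivalence_map X Y f \<longleftrightarrow>
     continuous_map X Y f \<and>
     (\<exists>g. continuous_map Y X g \<and>
          homotopic_with (\<lambda>x. True) X X (g \<circ> f) id \<and>
          homotopic_with (\<lambda>x. True) Y Y (f \<circ> g) id)"

text \<open>In a finite space, \<open>min_open X x\<close> is the minimal open set containing the point \<open>x\<close>
  (only meaningful for \<open>x \<in> topspace X\<close>).\<close>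

definition min_open :: "'a topology \<Rightarrow> 'a \<Rightarrow> 'a set" where
  "min_open X x = \<Inter>{U. openin X U \<and> x \<in> U}"

definition spec_le :: "'a topology \<Rightarrow> 'a \<Rightarrow> 'a \<Rightarrow> bool" where
  "spec_le X x y \<longleftrightarrow> x \<in> topspace X \<and> y \<in> topspace X \<and> min_open X x \<subseteq> min_open X y"

definition min_closed :: "'a topology \<Rightarrow> 'a \<Rightarrow> 'a set" where
  "min_closed X x = {z \<in> topspace X. spec_le X x z}"

definition mxl :: "'a topology \<Rightarrow> 'a set" where
  "mxl X = {x \<in> topspace X. \<forall>y \<in> topspace X. spec_le X x y \<longrightarrow> y = x}"

definition mnl :: "'a topology \<Rightarrow> 'a set" where
  "mnl X = {x \<in> topspace X. \<forall>y \<in> topspace X. spec_le X y x \<longrightarrow> y = x}"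

definition \<U>_set :: "'a topology \<Rightarrow> 'a set set" where
  "\<U>_set X = {C. \<exists>A. A \<noteq> {} \<and> A \<subseteq> mxl X \<and> (\<Inter>a\<in>A. min_open X a) \<noteq> {} \<and>
                   C \<in> connected_components_of (subtopology X (\<Inter>a\<in>A. min_open X a))}"

definition \<F>_set :: "'a topology \<Rightarrow> 'a set set" where
  "\<F>_set X = {C. \<exists>A. A \<noteq> {} \<and> A \<subseteq> mnl X \<and> (\<Inter>a\<in>A. min_closed X a) \<noteq> {} \<and>
                   C \<in> connected_components_of (subtopology X (\<Inter>a\<in>A. min_closed X a))}"

definition \<C>_le :: "'a topology \<Rightarrow> 'a set \<Rightarrow> 'a set \<Rightarrow> bool" where
  "\<C>_le X C1 C2 \<longleftrightarrow>
     (C1 \<in> \<U>_set X \<and> C2 \<in> \<U>_set X \<and> C1 \<subseteq> C2) \<or>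
     (C1 \<in> \<F>_set X \<and> C2 \<in> \<F>_set X \<and> C1 \<supseteq> C2) \<or>
     (C1 \<in> \<F>_set X \<and> C2 \<in> \<U>_set X \<and> C1 \<inter> C2 \<noteq> {})"

text \<open>The finite space associated with a poset \<open>(P, le)\<close>: the open sets are the down-sets.\<close>

definition poset_space :: "'a set \<Rightarrow> ('a \<Rightarrow> 'a \<Rightarrow> bool) \<Rightarrow> 'a topology" where
  "poset_space P le = topology (\<lambda>S. S \<subseteq> P \<and> (\<forall>x\<in>S. \<forall>y\<in>P. le y x \<longrightarrow> y \<in> S))"

lemma openin_poset_space:
  "openin (poset_space P le) S \<longleftrightarrow> S \<subseteq> P \<and> (\<forall>x\<in>S. \<forall>y\<in>P. le y x \<longrightarrow> y \<in> S)"
proof -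
  have "istopology (\<lambda>S. S \<subseteq> P \<and> (\<forall>x\<in>S. \<forall>y\<in>P. le y x \<longrightarrow> y \<in> S))"
    unfolding istopology_def by blast
  then show ?thesis
    by (simp add: poset_space_def)
qed

lemma topspace_poset_space: "topspace (poset_space P le) = P"
  unfolding topspace_def openin_poset_space by blast

definition \<U>_space :: "'a topology \<Rightarrow> 'a set topology" where
  "\<U>_space X = poset_space (\<U>_set X) (\<lambda>C1 C2. C1 \<subseteq> C2)"

definition \<F>_space :: "'a topology \<Rightarrow> 'a set topology" where
  "\<F>_space X = poset_space (\<F>_set X) (\<lambda>C1 C2. C1 \<supseteq> C2)"

definition \<C>_space :: "'a topology \<Rightarrow> 'a set topology" where
  "\<C>_space X = poset_space (\<U>_set X \<union> \<F>_set X) (\<C>_le X)"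

definition poset_min :: "('a \<Rightarrow> 'a \<Rightarrow> bool) \<Rightarrow> 'a set \<Rightarrow> 'a" where
  "poset_min le S = (THE m. m \<in> S \<and> (\<forall>s\<in>S. le m s))"

definition poset_max :: "('a \<Rightarrow> 'a \<Rightarrow> bool) \<Rightarrow> 'a set \<Rightarrow> 'a" where
  "poset_max le S = (THE m. m \<in> S \<and> (\<forall>s\<in>S. le s m))"

definition \<U>_map :: "'b topology \<Rightarrow> ('a \<Rightarrow> 'b) \<Rightarrow> 'a set \<Rightarrow> 'b set" where
  "\<U>_map Y f C = poset_min (\<lambda>D1 D2. D1 \<subseteq> D2) {D \<in> \<U>_set Y. f ` C \<subseteq> D}"

text \<open>The order is reverse inclusion, so the maximum is the smallest set for inclusion.\<close>

definition \<F>_map :: "'b topology \<Rightarrow> ('a \<Rightarrow> 'b) \<Rightarrow> 'a set \<Rightarrow> 'b set" where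
  "\<F>_map Y f C = poset_max (\<lambda>D1 D2. D1 \<supseteq> D2) {D \<in> \<F>_set Y. f ` C \<subseteq> D}"

text \<open>Only meaningful if \<open>\<U>_set X \<inter> \<F>_set X = {}\<close>.\<close>

definition \<C>_map ::
    "'a topology \<Rightarrow> 'b topology \<Rightarrow> ('a \<Rightarrow> 'b) \<Rightarrow> 'a set \<Rightarrow> 'b set" where
  "\<C>_map X Y f C = (if C \<in> \<U>_set X then \<U>_map Y f C else \<F>_map Y f C)"

end

theory Submission
  imports Defs
begin

text \<open>
  A component of an intersection of minimal open sets is open, a component of an intersection of
  minimal closed sets is closed, and both \<open>\<U>_map Y f\<close> and \<open>\<F>_map Y f\<close> send \<open>C\<close> to the least
  member of a family that contains \<open>f ` C\<close>.  This is all that the theorem depends on, so the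
  argument is carried out for an arbitrary family \<open>A\<close> of open sets, ordered by inclusion, glued
  below by a disjoint family \<open>B\<close> of closed sets, ordered by reverse inclusion.  The space
  \<open>\<U>_space X\<close> is the case of empty \<open>B\<close>, \<open>\<F>_space X\<close> that of empty \<open>A\<close>, and \<open>\<C>_space X\<close> uses
  both families.

  Write \<open>\<Phi> f\<close> for the map induced by \<open>f\<close>.  Two facts carry the proof.

  \<^item> If \<open>h\<close> is a homotopy from \<open>f\<close> to \<open>g\<close>, then \<open>(t, C) \<mapsto> \<Phi> (h t) C\<close> is a homotopy from \<open>\<Phi> f\<close>
    to \<open>\<Phi> g\<close> (\<open>homotopic_with_glued_map\<close>).  For an open set \<open>D\<close> and a finite set \<open>C\<close> the condition
    \<open>h t ` C \<subseteq> D\<close> is open in \<open>t\<close>, and for a closed \<open>D\<close> it is closed in \<open>t\<close>; so continuity is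
    read off directly, without replacing the homotopy by a chain of comparable maps.

  \<^item> \<open>\<Phi>\<close> respects composition up to homotopy (\<open>homotopic_with_glued_map_compose\<close>).  Equality can
    fail, but \<open>\<Phi> (g \<circ> f) C \<subseteq> \<Phi> g (\<Phi> f C)\<close> always holds, and order-preserving maps that are
    pointwise comparable are homotopic.

  Since \<open>\<Phi> id\<close> is the identity, \<open>\<Phi>\<close> sends a homotopy inverse of \<open>f\<close> to a homotopy inverse of
  \<open>\<Phi> f\<close>.  The least members exist by \<open>intersection_components_least_superset\<close>, because a
  continuous map sends each minimal open set into the minimal open set of a maximal point, and each
  minimal closed set into the minimal closed set of a minimal point.
\<close>

section \<open>Maps into and homotopies between poset spaces\<close>

text \<open>An open set of the target that contains \<open>H (t, C)\<close> contains every value below it, and the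
  down-set of \<open>C\<close> is a neighbourhood of \<open>C\<close>; so it suffices that near \<open>t\<close> and below \<open>C\<close> all values
  lie below \<open>H (t, C)\<close>.\<close>

lemma continuous_map_prod_poset_space:
  assumes refl: "\<And>C. C \<in> P \<Longrightarrow> le C C"
    and trans: "\<And>C D E. \<lbrakk>C \<in> P; D \<in> P; E \<in> P; le C D; le D E\<rbrakk> \<Longrightarrow> le C E"
    and maps: "\<And>t C. \<lbrakk>t \<in> topspace T; C \<in> P\<rbrakk> \<Longrightarrow> H (t, C) \<in> Q"
    and local: "\<And>t C. \<lbrakk>t \<in> topspace T; C \<in> P\<rbrakk> \<Longrightarrow>
      \<exists>W. openin T W \<and> t \<in> W \<and> (\<forall>s\<in>W. \<forall>C'\<in>P. le C' C \<longrightarrow> le' (H (s, C')) (H (t, C)))"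
  shows "continuous_map (prod_topology T (poset_space P le)) (poset_space Q le') H"
  unfolding continuous_map_def
proof (intro conjI allI impI)
  show "H \<in> topspace (prod_topology T (poset_space P le)) \<rightarrow> topspace (poset_space Q le')"
    using maps by (auto simp: topspace_poset_space)
next
  fix V assume V: "openin (poset_space Q le') V"
  let ?S = "{p \<in> topspace (prod_topology T (poset_space P le)). H p \<in> V}"
  show "openin (prod_topology T (poset_space P le)) ?S"
    unfolding openin_prod_topology_alt
  proof (intro allI impI)
    fix t C assume "(t, C) \<in> ?S"
    then have t: "t \<in> topspace T" and C: "C \<in> P" and HV: "H (t, C) \<in> V"
      by (auto simp: topspace_poset_space)
    from local[OF t C] obtain W where W: "openin T W" "t \<in> W"
      and "\<forall>s\<in>W. \<forall>C'\<in>P. le C' C \<longrightarrow> le' (H (s, C')) (H (t, C))"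
      by (elim exE conjE)
    then have le: "\<And>s C'. \<lbrakk>s \<in> W; C' \<in> P; le C' C\<rbrakk> \<Longrightarrow> le' (H (s, C')) (H (t, C))"
      by simp
    let ?D = "{C' \<in> P. le C' C}"
    have D: "openin (poset_space P le) ?D"
      unfolding openin_poset_space using trans[OF _ _ C] by fast
    have "W \<times> ?D \<subseteq> ?S"
    proof clarsimp
      fix s C' assume s: "s \<in> W" and C': "C' \<in> P" "le C' C"
      have sT: "s \<in> topspace T" using s W openin_subset by blast
      moreover have "H (s, C') \<in> V"
        using V HV le[OF s C'] maps[OF sT C'(1)] by (auto simp: openin_poset_space)
      ultimately show "s \<in> topspace T \<and> C' \<in> topspace (poset_space P le) \<and> H (s, C') \<in> V"
        using C' by (simp add: topspace_poset_space)
    qed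
    then show "\<exists>U D. openin T U \<and> openin (poset_space P le) D \<and> t \<in> U \<and> C \<in> D \<and> U \<times> D \<subseteq> ?S"
      using W D C refl by blast
  qed
qed

text \<open>The homotopy stays at the smaller map on the half-open interval and jumps to the larger map
  at time 1; the jump is continuous because every open set containing a value of the larger map
  contains the corresponding value of the smaller one.\<close>

lemma homotopic_with_poset_space_pointwise_le:
  assumes refl: "\<And>C. C \<in> P \<Longrightarrow> le C C"
    and trans: "\<And>C D E. \<lbrakk>C \<in> P; D \<in> P; E \<in> P; le C D; le D E\<rbrakk> \<Longrightarrow> le C E"
    and trans': "\<And>C D E. \<lbrakk>C \<in> Q; D \<in> Q; E \<in> Q; le' C D; le' D E\<rbrakk> \<Longrightarrow> le' C E"
    and k: "\<And>C. C \<in> P \<Longrightarrow> k C \<in> Q" "\<And>C D. \<lbrakk>C \<in> P; D \<in> P; le C D\<rbrakk> \<Longrightarrow> le' (k C) (k D)"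
    and l: "\<And>C. C \<in> P \<Longrightarrow> l C \<in> Q" "\<And>C D. \<lbrakk>C \<in> P; D \<in> P; le C D\<rbrakk> \<Longrightarrow> le' (l C) (l D)"
    and kl: "\<And>C. C \<in> P \<Longrightarrow> le' (k C) (l C)"
  shows "homotopic_with (\<lambda>x. True) (poset_space P le) (poset_space Q le') k l"
proof -
  let ?I = "top_of_set {0..1::real}"
  let ?H = "\<lambda>(t::real, C). if t = 1 then l C else k C"
  have "continuous_map (prod_topology ?I (poset_space P le)) (poset_space Q le') ?H"
  proof (rule continuous_map_prod_poset_space)
    fix t :: real and C assume t: "t \<in> topspace ?I" and C: "C \<in> P"
    show "\<exists>W. openin ?I W \<and> t \<in> W \<and>
        (\<forall>s\<in>W. \<forall>C'\<in>P. le C' C \<longrightarrow> le' (?H (s, C')) (?H (t, C)))"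
    proof (cases "t = 1")
      case True
      have "le' (l C') (l C)" "le' (k C') (l C)" if "C' \<in> P" "le C' C" for C'
      proof -
        show "le' (l C') (l C)" by (rule l(2)[OF that(1) C that(2)])
        then show "le' (k C') (l C)"
          by (rule trans'[OF k(1)[OF that(1)] l(1)[OF that(1)] l(1)[OF C] kl[OF that(1)]])
      qed
      then have "\<forall>s\<in>topspace ?I. \<forall>C'\<in>P. le C' C \<longrightarrow> le' (?H (s, C')) (?H (t, C))"
        by (simp add: True)
      then show ?thesis using t openin_topspace by blast
    next
      case False
      have "openin ?I ({0..1} \<inter> {..<1})"
        by (simp add: openin_open_Int)
      moreover have "t \<in> {0..1} \<inter> {..<1}" using t False by simp
      moreover have "\<forall>s\<in>{0..1} \<inter> {..<1}. \<forall>C'\<in>P. le C' C \<longrightarrow> le' (?H (s, C')) (?H (t, C))"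
        using False k(2)[OF _ C] by simp
      ultimately show ?thesis by blast
    qed
    show "?H (t, C) \<in> Q" using k(1)[OF C] l(1)[OF C] by simp
  qed (fact refl trans)+
  then show ?thesis
    unfolding homotopic_with_def
  proof (intro exI[of _ ?H] conjI)
    show "\<forall>C. ?H (0, C) = k C" "\<forall>C. ?H (1, C) = l C" by simp_all
  qed auto
qed

lemma homotopy_equivalence_map_cong:
  assumes "homotopy_equivalence_map X Y f" and eq: "\<And>x. x \<in> topspace X \<Longrightarrow> f' x = f x"
  shows "homotopy_equivalence_map X Y f'"
proof -
  obtain g where f: "continuous_map X Y f" and g: "continuous_map Y X g"
    and gf: "homotopic_with (\<lambda>x. True) X X (g \<circ> f) id"
    and fg: "homotopic_with (\<lambda>x. True) Y Y (f \<circ> g) id"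
    using assms by (auto simp: homotopy_equivalence_map_def)
  have f': "continuous_map X Y f'"
    using f eq by (metis continuous_map_eq)
  have "homotopic_with (\<lambda>x. True) X X (g \<circ> f') (g \<circ> f)"
    using continuous_map_compose[OF f' g] eq by (intro homotopic_with_equal) auto
  from homotopic_with_trans[OF this gf] have gf': "homotopic_with (\<lambda>x. True) X X (g \<circ> f') id" .
  have "homotopic_with (\<lambda>x. True) Y Y (f' \<circ> g) (f \<circ> g)"
    using continuous_map_compose[OF g f'] eq g
    by (intro homotopic_with_equal) (auto simp: continuous_map_def Pi_iff)
  from homotopic_with_trans[OF this fg] have "homotopic_with (\<lambda>x. True) Y Y (f' \<circ> g) id" .
  then show ?thesis
    using f' g gf' unfolding homotopy_equivalence_map_def by blast
qed

section \<open>Gluing a family of open sets to a family of closed sets\<close>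

text \<open>Taking \<open>B\<close> empty gives \<open>A\<close> ordered by inclusion, taking \<open>A\<close> empty gives \<open>B\<close> ordered by
  reverse inclusion; so one argument serves all three constructions.\<close>

definition glued_le :: "'a set set \<Rightarrow> 'a set set \<Rightarrow> 'a set \<Rightarrow> 'a set \<Rightarrow> bool" where
  "glued_le A B C D \<longleftrightarrow>
     (C \<in> A \<and> D \<in> A \<and> C \<subseteq> D) \<or> (C \<in> B \<and> D \<in> B \<and> D \<subseteq> C) \<or> (C \<in> B \<and> D \<in> A \<and> C \<inter> D \<noteq> {})"

definition glued_space :: "'a set set \<Rightarrow> 'a set set \<Rightarrow> 'a set topology" where
  "glued_space A B = poset_space (A \<union> B) (glued_le A B)"

definition least_superset :: "'a set set \<Rightarrow> 'a set \<Rightarrow> 'a set" where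
  "least_superset K S = poset_min (\<subseteq>) {D \<in> K. S \<subseteq> D}"

text \<open>The case distinction is unambiguous only if \<open>A\<close> is disjoint from the closed family of the
  source.\<close>

definition glued_map ::
    "'a set set \<Rightarrow> 'b set set \<Rightarrow> 'b set set \<Rightarrow> ('a \<Rightarrow> 'b) \<Rightarrow> 'a set \<Rightarrow> 'b set" where
  "glued_map A A' B' f C =
     (if C \<in> A then least_superset A' (f ` C) else least_superset B' (f ` C))"

definition open_closed_families :: "'a topology \<Rightarrow> 'a set set \<Rightarrow> 'a set set \<Rightarrow> bool" where
  "open_closed_families X A B \<longleftrightarrow>
     finite (topspace X) \<and> (\<forall>C\<in>A. openin X C) \<and> (\<forall>C\<in>B. closedin X C) \<and> A \<inter> B = {}"

definition images_have_least_supersets ::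
    "'a topology \<Rightarrow> 'a set set \<Rightarrow> 'b topology \<Rightarrow> 'b set set \<Rightarrow> bool" where
  "images_have_least_supersets X A Y A' \<longleftrightarrow>
     (\<forall>f. continuous_map X Y f \<longrightarrow>
        (\<forall>C\<in>A. \<exists>D\<in>A'. f ` C \<subseteq> D \<and> (\<forall>E\<in>A'. f ` C \<subseteq> E \<longrightarrow> D \<subseteq> E)))"

lemma least_superset_eqI:
  assumes "D \<in> K" "S \<subseteq> D" "\<And>E. \<lbrakk>E \<in> K; S \<subseteq> E\<rbrakk> \<Longrightarrow> D \<subseteq> E"
  shows "least_superset K S = D"
  unfolding least_superset_def poset_min_def using assms by (intro the_equality) blast+

lemma least_superset_image:
  assumes "images_have_least_supersets X A Y A'" "continuous_map X Y f" "C \<in> A"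
  shows "least_superset A' (f ` C) \<in> A'"
    and "f ` C \<subseteq> least_superset A' (f ` C)"
    and "\<And>E. \<lbrakk>E \<in> A'; f ` C \<subseteq> E\<rbrakk> \<Longrightarrow> least_superset A' (f ` C) \<subseteq> E"
proof -
  obtain D where D: "D \<in> A'" "f ` C \<subseteq> D" "\<And>E. \<lbrakk>E \<in> A'; f ` C \<subseteq> E\<rbrakk> \<Longrightarrow> D \<subseteq> E"
    using assms unfolding images_have_least_supersets_def by meson
  have eq: "least_superset A' (f ` C) = D" by (rule least_superset_eqI[OF D])
  show "least_superset A' (f ` C) \<in> A'" "f ` C \<subseteq> least_superset A' (f ` C)"
    "\<And>E. \<lbrakk>E \<in> A'; f ` C \<subseteq> E\<rbrakk> \<Longrightarrow> least_superset A' (f ` C) \<subseteq> E"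
    unfolding eq using D by auto
qed

lemma glued_le_refl: "C \<in> A \<union> B \<Longrightarrow> glued_le A B C C"
  by (auto simp: glued_le_def)

text \<open>Disjointness of the families is needed here: for a set belonging to both, the relation
  \<open>F \<le> C\<close> given by meeting \<open>C\<close> and the relation \<open>C \<le> F'\<close> given by containing \<open>F'\<close> would not
  compose.\<close>

lemma glued_le_trans:
  "\<lbrakk>A \<inter> B = {}; glued_le A B C D; glued_le A B D E\<rbrakk> \<Longrightarrow> glued_le A B C E"
  unfolding glued_le_def by blast

lemma glued_space_empty_right: "glued_space A {} = poset_space A (\<subseteq>)"
  unfolding glued_space_def topology_eq openin_poset_space glued_le_def by blast

lemma glued_space_empty_left: "glued_space {} B = poset_space B (\<lambda>C D. D \<subseteq> C)"
  unfolding glued_space_def topology_eq openin_poset_space glued_le_def by blast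

text \<open>A point map \<open>p\<close> with \<open>p ` C \<subseteq> \<phi> C\<close> sends a common point of \<open>C\<close> and \<open>D\<close> to a common point
  of \<open>\<phi> C\<close> and \<open>\<phi> D\<close>, which is what the relations between the two families require.\<close>

lemma glued_le_mono:
  assumes "A \<inter> B = {}"
    and "\<And>C. C \<in> A \<Longrightarrow> \<phi> C \<in> A'" "\<And>C. C \<in> B \<Longrightarrow> \<phi> C \<in> B'"
    and "\<And>C D. \<lbrakk>C \<in> A; D \<in> A; C \<subseteq> D\<rbrakk> \<Longrightarrow> \<phi> C \<subseteq> \<phi> D"
    and "\<And>C D. \<lbrakk>C \<in> B; D \<in> B; C \<subseteq> D\<rbrakk> \<Longrightarrow> \<phi> C \<subseteq> \<phi> D"
    and "\<And>C. C \<in> A \<union> B \<Longrightarrow> p ` C \<subseteq> \<phi> C"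
    and "glued_le A B C D"
  shows "glued_le A' B' (\<phi> C) (\<phi> D)"
proof -
  consider "C \<in> A" "D \<in> A" "C \<subseteq> D" | "C \<in> B" "D \<in> B" "D \<subseteq> C"
    | x where "C \<in> B" "D \<in> A" "x \<in> C" "x \<in> D"
    using assms(7) unfolding glued_le_def by blast
  then show ?thesis
  proof cases
    case 3
    then have "p x \<in> \<phi> C \<inter> \<phi> D" using assms(6) by blast
    then show ?thesis using 3 assms(2,3) unfolding glued_le_def by blast
  qed (use assms(2-5) in \<open>auto simp: glued_le_def\<close>)
qed

lemma least_superset_image_mono:
  assumes "images_have_least_supersets X A Y A'" "continuous_map X Y f"
    and "C \<in> A" "D \<in> A" "C \<subseteq> D"
  shows "least_superset A' (f ` C) \<subseteq> least_superset A' (f ` D)"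
  by (meson assms image_mono least_superset_image subset_trans)

section \<open>Homotopies induce homotopies\<close>

lemma openin_finite_Inter_preimages:
  assumes "finite J" "\<And>j. j \<in> J \<Longrightarrow> openin T {t \<in> topspace T. P j t}"
  shows "openin T {t \<in> topspace T. \<forall>j\<in>J. P j t}"
proof -
  have "{t \<in> topspace T. \<forall>j\<in>J. P j t} = topspace T \<inter> (\<Inter>j\<in>J. {t \<in> topspace T. P j t})"
    by auto
  then show ?thesis using assms by (auto intro!: openin_Int_Inter)
qed

text \<open>Continuity at \<open>(t, C)\<close> requires that \<open>\<Phi> (h s) C \<le> \<Phi> (h t) C\<close> in the glued order for \<open>s\<close>
  near \<open>t\<close>.  For \<open>C\<close> in the open family this is an inclusion into an open set \<open>D\<close> with
  \<open>h t ` C \<subseteq> D\<close>, and \<open>h s ` C \<subseteq> D\<close> persists for \<open>s\<close> near \<open>t\<close> as \<open>C\<close> is finite.  For \<open>C\<close> in the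
  closed family the inclusion goes the other way: every one of the finitely many closed sets \<open>E\<close>
  that fails to contain \<open>h t ` C\<close> still fails to contain \<open>h s ` C\<close>, so a member that contains
  \<open>h s ` C\<close> contains \<open>h t ` C\<close>.\<close>

lemma homotopic_with_glued_map:
  fixes X :: "'a topology" and Y :: "'b topology"
  assumes X: "open_closed_families X A B" and Y: "open_closed_families Y A' B'"
    and LA: "images_have_least_supersets X A Y A'"
    and LB: "images_have_least_supersets X B Y B'"
    and fg: "homotopic_with (\<lambda>x. True) X Y f g"
  shows "homotopic_with (\<lambda>x. True) (glued_space A B) (glued_space A' B')
           (glued_map A A' B' f) (glued_map A A' B' g)"
proof -
  let ?I = "top_of_set {0..1::real}"
  obtain h where h: "continuous_map (prod_topology ?I X) Y h"
    and h0: "\<And>x. h (0, x) = f x" and h1: "\<And>x. h (1, x) = g x"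
    using fg unfolding homotopic_with_def by auto
  let ?h = "\<lambda>t x. h (t, x)"
  let ?H = "\<lambda>(t, C). glued_map A A' B' (?h t) C"
  have disj: "A \<inter> B = {}" using X by (simp add: open_closed_families_def)
  have slice: "continuous_map X Y (?h t)" if "t \<in> topspace ?I" for t
    using continuous_map_compose[OF _ h, of X "\<lambda>x. (t, x)"] that
    by (simp add: o_def continuous_map_pairedI)
  have curve: "continuous_map ?I Y (\<lambda>t. h (t, x))" if "x \<in> topspace X" for x
    using continuous_map_compose[OF _ h, of ?I "\<lambda>t. (t, x)"] that
    by (simp add: o_def continuous_map_pairedI)
  have subX: "C \<subseteq> topspace X" if "C \<in> A \<union> B" for C
    using X that closedin_subset[of X C] openin_subset[of X C]
    unfolding open_closed_families_def by blast
  have finX: "finite C" if "C \<in> A \<union> B" for C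
    using subX[OF that] X finite_subset by (auto simp: open_closed_families_def)
  have finB': "finite B'"
  proof -
    have "B' \<subseteq> Pow (topspace Y)"
      using Y closedin_subset by (auto simp: open_closed_families_def)
    then show ?thesis using Y finite_subset by (auto simp: open_closed_families_def)
  qed
  have cont: "continuous_map (prod_topology ?I (glued_space A B)) (glued_space A' B') ?H"
    unfolding glued_space_def
  proof (rule continuous_map_prod_poset_space)
    fix t C assume t: "t \<in> topspace ?I" and C: "C \<in> A \<union> B"
    show "?H (t, C) \<in> A' \<union> B'"
      using C least_superset_image(1)[OF LA slice[OF t]] least_superset_image(1)[OF LB slice[OF t]]
      by (auto simp: glued_map_def)
    show "\<exists>W. openin ?I W \<and> t \<in> W \<and>
        (\<forall>s\<in>W. \<forall>C'\<in>A \<union> B. glued_le A B C' C \<longrightarrow> glued_le A' B' (?H (s, C')) (?H (t, C)))"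
    proof (cases "C \<in> A")
      case True
      define D where "D = least_superset A' (?h t ` C)"
      note D = least_superset_image[OF LA slice[OF t] True, folded D_def]
      define W where "W = {s \<in> topspace ?I. \<forall>x\<in>C. h (s, x) \<in> D}"
      have "openin Y D" using D(1) Y by (auto simp: open_closed_families_def)
      then have "openin ?I W"
        unfolding W_def using finX[OF C] subX[OF C] curve
        by (intro openin_finite_Inter_preimages openin_continuous_map_preimage) blast+
      moreover have "t \<in> W" using t D(2) by (auto simp: W_def)
      moreover have "glued_le A' B' (?H (s, C')) (?H (t, C))"
        if s: "s \<in> W" and C': "C' \<in> A \<union> B" and le: "glued_le A B C' C" for s C'
      proof -
        have sI: "s \<in> topspace ?I" and sD: "?h s ` C \<subseteq> D" using s by (auto simp: W_def)
        have HD: "?H (t, C) = D" using True by (simp add: glued_map_def D_def)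
        consider "C' \<in> A" "C' \<subseteq> C" | x where "C' \<in> B" "C' \<notin> A" "x \<in> C'" "x \<in> C"
          using le True disj unfolding glued_le_def by blast
        then show ?thesis
        proof cases
          case 1
          note E = least_superset_image[OF LA slice[OF sI] 1(1)]
          have "?h s ` C' \<subseteq> D" using 1(2) sD by blast
          then have "least_superset A' (?h s ` C') \<subseteq> D" using E(3) D(1) by blast
          then show ?thesis unfolding HD using 1(1) E(1) D(1)
            by (simp add: glued_map_def glued_le_def)
        next
          case 2
          \<comment> \<open>The common point \<open>x\<close> of \<open>C'\<close> and \<open>C\<close> is moved to a common point of the images.\<close>
          note E = least_superset_image[OF LB slice[OF sI] 2(1)]
          have "h (s, x) \<in> least_superset B' (?h s ` C') \<inter> D" using E(2) sD 2 by blast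
          then show ?thesis unfolding HD using 2 E(1) D(1)
            by (auto simp: glued_map_def glued_le_def)
        qed
      qed
      ultimately show ?thesis by blast
    next
      case False
      then have CB: "C \<in> B" using C by blast
      define D where "D = least_superset B' (?h t ` C)"
      note D = least_superset_image[OF LB slice[OF t] CB, folded D_def]
      define J where "J = {E \<in> B'. \<not> ?h t ` C \<subseteq> E}"
      define W where "W = {s \<in> topspace ?I. \<forall>E\<in>J. \<exists>x\<in>C. h (s, x) \<in> topspace Y - E}"
      have "openin ?I {s \<in> topspace ?I. \<exists>x\<in>C. h (s, x) \<in> topspace Y - E}" if "E \<in> J" for E
      proof -
        have "openin Y (topspace Y - E)"
          using that Y by (auto simp: J_def open_closed_families_def)
        then have "openin ?I {s \<in> topspace ?I. h (s, x) \<in> topspace Y - E}" if "x \<in> C" for x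
          using openin_continuous_map_preimage[OF curve] subX[OF C] that by blast
        then have "openin ?I (\<Union>x\<in>C. {s \<in> topspace ?I. h (s, x) \<in> topspace Y - E})"
          by (intro openin_Union) blast
        moreover have "(\<Union>x\<in>C. {s \<in> topspace ?I. h (s, x) \<in> topspace Y - E})
            = {s \<in> topspace ?I. \<exists>x\<in>C. h (s, x) \<in> topspace Y - E}" by blast
        ultimately show ?thesis by simp
      qed
      moreover have "finite J" using finB' by (simp add: J_def)
      ultimately have "openin ?I W"
        unfolding W_def by (intro openin_finite_Inter_preimages)
      moreover have "t \<in> W"
      proof -
        have "?h t ` C \<subseteq> topspace Y"
          using slice[OF t] subX[OF C] by (auto simp: continuous_map_def Pi_iff)
        then show ?thesis using t unfolding W_def J_def by blast
      qed
      moreover have "glued_le A' B' (?H (s, C')) (?H (t, C))"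
        if s: "s \<in> W" and C': "C' \<in> A \<union> B" and le: "glued_le A B C' C" for s C'
      proof -
        have sI: "s \<in> topspace ?I" using s by (simp add: W_def)
        have C'B: "C' \<in> B" "C' \<notin> A" "C \<subseteq> C'"
          using le False disj unfolding glued_le_def by blast+
        note E = least_superset_image[OF LB slice[OF sI] C'B(1)]
        let ?E = "least_superset B' (?h s ` C')"
        have "?h s ` C \<subseteq> ?E" using E(2) C'B(3) by blast
        then have "?E \<notin> J" using s unfolding W_def by blast
        then have "D \<subseteq> ?E" using E(1) D(3) unfolding J_def by blast
        then show ?thesis using C'B False E(1) D(1)
          by (simp add: glued_map_def glued_le_def D_def)
      qed
      ultimately show ?thesis by blast
    qed
  qed (fact glued_le_refl, rule glued_le_trans[OF disj])
  have h0': "?h 0 = f" and h1': "?h 1 = g" using h0 h1 by auto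
  show ?thesis
    unfolding homotopic_with_def
  proof (intro exI[of _ ?H] conjI)
    show "\<forall>C. ?H (0, C) = glued_map A A' B' f C" "\<forall>C. ?H (1, C) = glued_map A A' B' g C"
      using h0' h1' by simp_all
  qed (use cont in auto)
qed

text \<open>The assignment is functorial only up to homotopy: the least superset of \<open>g (f C)\<close> may be
  strictly smaller than the one obtained in two steps.  On the open family this makes the
  composite the larger map, on the closed family the smaller one; the intermediate map \<open>k\<close>
  picks the smaller of the two on each family and lies below both.\<close>

lemma homotopic_with_glued_map_compose:
  fixes X :: "'a topology" and Y :: "'b topology" and Z :: "'c topology"
  assumes dX: "A \<inter> B = {}" and dY: "A' \<inter> B' = {}" and dZ: "A'' \<inter> B'' = {}"
    and LA: "images_have_least_supersets X A Y A'" "images_have_least_supersets Y A' Z A''"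
      "images_have_least_supersets X A Z A''"
    and LB: "images_have_least_supersets X B Y B'" "images_have_least_supersets Y B' Z B''"
      "images_have_least_supersets X B Z B''"
    and f: "continuous_map X Y f" and g: "continuous_map Y Z g"
  shows "homotopic_with (\<lambda>x. True) (glued_space A B) (glued_space A'' B'')
           (glued_map A' A'' B'' g \<circ> glued_map A A' B' f) (glued_map A A'' B'' (g \<circ> f))"
proof -
  have gf: "continuous_map X Z (g \<circ> f)" using f g by (rule continuous_map_compose)
  let ?l = "glued_map A' A'' B'' g \<circ> glued_map A A' B' f"
  let ?m = "glued_map A A'' B'' (g \<circ> f)"
  let ?k = "\<lambda>C. if C \<in> A then ?m C else ?l C"
  have mA: "?m C = least_superset A'' ((g \<circ> f) ` C)" if "C \<in> A" for C
    using that by (simp add: glued_map_def)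
  have mB: "?m C = least_superset B'' ((g \<circ> f) ` C)" if "C \<in> B" for C
    using that dX by (auto simp: glued_map_def)
  have lA: "?l C = least_superset A'' (g ` least_superset A' (f ` C))" if "C \<in> A" for C
    using that least_superset_image(1)[OF LA(1) f that] by (simp add: glued_map_def)
  have lB: "?l C = least_superset B'' (g ` least_superset B' (f ` C))" if "C \<in> B" for C
    using that least_superset_image(1)[OF LB(1) f that] dX dY by (auto simp: glued_map_def)
  note lsA = least_superset_image[OF LA(1) f] and lsB = least_superset_image[OF LB(1) f]
  note l2A = least_superset_image[OF LA(2) g lsA(1)] and l2B = least_superset_image[OF LB(2) g lsB(1)]
  note m2A = least_superset_image[OF LA(3) gf] and m2B = least_superset_image[OF LB(3) gf]
  have l_in: "C \<in> A \<Longrightarrow> ?l C \<in> A''" "C \<in> B \<Longrightarrow> ?l C \<in> B''" for C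
    using l2A(1) l2B(1) lA lB by metis+
  have m_in: "C \<in> A \<Longrightarrow> ?m C \<in> A''" "C \<in> B \<Longrightarrow> ?m C \<in> B''" for C
    using m2A(1) m2B(1) mA mB by metis+
  have l_monoA: "?l C \<subseteq> ?l D" if "C \<in> A" "D \<in> A" "C \<subseteq> D" for C D
    unfolding lA[OF that(1)] lA[OF that(2)]
    by (intro least_superset_image_mono[OF LA(2) g] lsA(1) least_superset_image_mono[OF LA(1) f] that)
  have l_monoB: "?l C \<subseteq> ?l D" if "C \<in> B" "D \<in> B" "C \<subseteq> D" for C D
    unfolding lB[OF that(1)] lB[OF that(2)]
    by (intro least_superset_image_mono[OF LB(2) g] lsB(1) least_superset_image_mono[OF LB(1) f] that)
  have m_monoA: "?m C \<subseteq> ?m D" if "C \<in> A" "D \<in> A" "C \<subseteq> D" for C D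
    unfolding mA[OF that(1)] mA[OF that(2)] by (intro least_superset_image_mono[OF LA(3) gf] that)
  have m_monoB: "?m C \<subseteq> ?m D" if "C \<in> B" "D \<in> B" "C \<subseteq> D" for C D
    unfolding mB[OF that(1)] mB[OF that(2)] by (intro least_superset_image_mono[OF LB(3) gf] that)
  have l_sub: "(g \<circ> f) ` C \<subseteq> ?l C" if "C \<in> A \<union> B" for C
  proof (cases "C \<in> A")
    case True
    have "(g \<circ> f) ` C \<subseteq> g ` least_superset A' (f ` C)" using lsA(2)[OF True] by auto
    then show ?thesis unfolding lA[OF True] using l2A(2)[OF True] by (rule subset_trans)
  next
    case False
    then have CB: "C \<in> B" using that by blast
    have "(g \<circ> f) ` C \<subseteq> g ` least_superset B' (f ` C)" using lsB(2)[OF CB] by auto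
    then show ?thesis unfolding lB[OF CB] using l2B(2)[OF CB] by (rule subset_trans)
  qed
  have m_sub: "(g \<circ> f) ` C \<subseteq> ?m C" if "C \<in> A \<union> B" for C
    using that m2A(2) m2B(2) mA mB by (metis UnE)
  have ml: "?m C \<subseteq> ?l C" if C: "C \<in> A \<union> B" for C
  proof (cases "C \<in> A")
    case True
    show ?thesis using m2A(3)[OF True l_in(1)[OF True] l_sub[OF C]] mA[OF True] by simp
  next
    case False
    then have CB: "C \<in> B" using that by blast
    show ?thesis using m2B(3)[OF CB l_in(2)[OF CB] l_sub[OF C]] mB[OF CB] by simp
  qed
  have notA: "C \<notin> A" if "C \<in> B" for C using that dX by blast
  have l_mono: "glued_le A'' B'' (?l C) (?l D)" if "glued_le A B C D" for C D
    using l_in l_monoA l_monoB l_sub that by (rule glued_le_mono[OF dX])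
  have m_mono: "glued_le A'' B'' (?m C) (?m D)" if "glued_le A B C D" for C D
    using m_in m_monoA m_monoB m_sub that by (rule glued_le_mono[OF dX])
  have k_mono: "glued_le A'' B'' (?k C) (?k D)" if "glued_le A B C D" for C D
  proof (rule glued_le_mono[OF dX _ _ _ _ _ that, where p = "g \<circ> f"])
    show "(g \<circ> f) ` C \<subseteq> ?k C" if "C \<in> A \<union> B" for C
      using l_sub[OF that] m_sub[OF that] by presburger
    show "?k C \<subseteq> ?k D" if "C \<in> A" "D \<in> A" "C \<subseteq> D" for C D
      using m_monoA[OF that] that by presburger
    show "?k C \<subseteq> ?k D" if "C \<in> B" "D \<in> B" "C \<subseteq> D" for C D
      using l_monoB[OF that] that notA by presburger
  qed (use m_in l_in notA in presburger)+
  have kl: "glued_le A'' B'' (?k C) (?l C)" if C: "C \<in> A \<union> B" for C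
    using C ml[OF C] l_in[of C] m_in[of C] notA[of C]
    by (cases "C \<in> A") (simp_all add: glued_le_def del: comp_apply)
  have km: "glued_le A'' B'' (?k C) (?m C)" if C: "C \<in> A \<union> B" for C
    using C ml[OF C] l_in[of C] m_in[of C] notA[of C]
    by (cases "C \<in> A") (simp_all add: glued_le_def del: comp_apply)
  have k_in: "?k C \<in> A'' \<union> B''" if "C \<in> A \<union> B" for C
    using that l_in[of C] m_in[of C] by auto
  have "homotopic_with (\<lambda>x. True) (glued_space A B) (glued_space A'' B'') ?k ?l"
    unfolding glued_space_def
  proof (rule homotopic_with_poset_space_pointwise_le)
    show "?l C \<in> A'' \<union> B''" if "C \<in> A \<union> B" for C using that l_in[of C] by blast
  qed (use k_in k_mono l_mono kl in \<open>blast intro: glued_le_refl glued_le_trans[OF dX] glued_le_trans[OF dZ]\<close>)+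
  moreover have "homotopic_with (\<lambda>x. True) (glued_space A B) (glued_space A'' B'') ?k ?m"
    unfolding glued_space_def
  proof (rule homotopic_with_poset_space_pointwise_le)
    show "?m C \<in> A'' \<union> B''" if "C \<in> A \<union> B" for C using that m_in[of C] by blast
  qed (use k_in k_mono m_mono km in \<open>blast intro: glued_le_refl glued_le_trans[OF dX] glued_le_trans[OF dZ]\<close>)+
  ultimately show ?thesis
    by (meson homotopic_with_symD homotopic_with_trans)
qed

lemma glued_map_id:
  assumes "C \<in> A \<union> B"
  shows "glued_map A A B id C = C"
proof -
  have "least_superset K (id ` C) = C" if "C \<in> K" for K
    using that by (intro least_superset_eqI) auto
  then show ?thesis using assms by (auto simp: glued_map_def)
qed

lemma homotopy_equivalence_map_glued_map:
  fixes X :: "'a topology" and Y :: "'b topology"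
  assumes X: "open_closed_families X A B" and Y: "open_closed_families Y A' B'"
    and LA: "images_have_least_supersets X A Y A'" "images_have_least_supersets Y A' X A"
      "images_have_least_supersets X A X A" "images_have_least_supersets Y A' Y A'"
    and LB: "images_have_least_supersets X B Y B'" "images_have_least_supersets Y B' X B"
      "images_have_least_supersets X B X B" "images_have_least_supersets Y B' Y B'"
    and f: "homotopy_equivalence_map X Y f"
  shows "homotopy_equivalence_map (glued_space A B) (glued_space A' B') (glued_map A A' B' f)"
proof -
  obtain g where f: "continuous_map X Y f" and g: "continuous_map Y X g"
    and gf: "homotopic_with (\<lambda>x. True) X X (g \<circ> f) id"
    and fg: "homotopic_with (\<lambda>x. True) Y Y (f \<circ> g) id"
    using f by (auto simp: homotopy_equivalence_map_def)
  have dX: "A \<inter> B = {}" and dY: "A' \<inter> B' = {}"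
    using X Y by (auto simp: open_closed_families_def)
  let ?f = "glued_map A A' B' f" and ?g = "glued_map A' A B g"
  have cf: "continuous_map (glued_space A B) (glued_space A' B') ?f"
    using homotopic_with_glued_map[OF X Y LA(1) LB(1), of f f] f
    by (simp add: homotopic_with_imp_continuous_maps)
  have cg: "continuous_map (glued_space A' B') (glued_space A B) ?g"
    using homotopic_with_glued_map[OF Y X LA(2) LB(2), of g g] g
    by (simp add: homotopic_with_imp_continuous_maps)
  have idX: "homotopic_with (\<lambda>x. True) (glued_space A B) (glued_space A B) (glued_map A A B id) id"
    by (rule homotopic_with_symD, rule homotopic_with_equal)
      (auto simp: glued_map_id glued_space_def topspace_poset_space)
  have idY: "homotopic_with (\<lambda>x. True) (glued_space A' B') (glued_space A' B')
      (glued_map A' A' B' id) id"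
    by (rule homotopic_with_symD, rule homotopic_with_equal)
      (auto simp: glued_map_id glued_space_def topspace_poset_space)
  have "homotopic_with (\<lambda>x. True) (glued_space A B) (glued_space A B) (?g \<circ> ?f) id"
    using homotopic_with_glued_map_compose[OF dX dY dX LA(1-3) LB(1-3) f g]
      homotopic_with_glued_map[OF X X LA(3) LB(3) gf] idX
    by (meson homotopic_with_trans)
  moreover have "homotopic_with (\<lambda>x. True) (glued_space A' B') (glued_space A' B') (?f \<circ> ?g) id"
    using homotopic_with_glued_map_compose[OF dY dX dY LA(2,1,4) LB(2,1,4) g f]
      homotopic_with_glued_map[OF Y Y LA(4) LB(4) fg] idY
    by (meson homotopic_with_trans)
  ultimately show ?thesis
    using cf cg unfolding homotopy_equivalence_map_def by blast
qed

section \<open>Least elements among components of intersections\<close>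

definition intersection_components ::
    "'a topology \<Rightarrow> ('i \<Rightarrow> 'a set) \<Rightarrow> 'i set \<Rightarrow> 'a set set" where
  "intersection_components X N I = {C. \<exists>A. A \<noteq> {} \<and> A \<subseteq> I \<and> (\<Inter>a\<in>A. N a) \<noteq> {} \<and>
     C \<in> connected_components_of (subtopology X (\<Inter>a\<in>A. N a))}"

lemma intersection_components_connectedin:
  assumes "C \<in> intersection_components X N I"
  shows "connectedin X C" "C \<noteq> {}" "\<exists>a\<in>I. C \<subseteq> N a"
proof -
  obtain A where A: "A \<noteq> {}" "A \<subseteq> I"
    and C: "C \<in> connected_components_of (subtopology X (\<Inter>a\<in>A. N a))"
    using assms by (auto simp: intersection_components_def)
  have c: "connectedin (subtopology X (\<Inter>a\<in>A. N a)) C"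
    using C by (rule connectedin_connected_components_of)
  then show "connectedin X C" by (simp add: connectedin_subtopology)
  obtain a where "a \<in> A" using A by blast
  moreover have "C \<subseteq> (\<Inter>a\<in>A. N a)" using c by (simp add: connectedin_subtopology)
  ultimately show "\<exists>a\<in>I. C \<subseteq> N a" using A by blast
  show "C \<noteq> {}" using C by (rule nonempty_connected_components_of)
qed

text \<open>The least member is the component containing \<open>S\<close> of the intersection of all \<open>N a\<close> that
  contain \<open>S\<close>: any other member containing \<open>S\<close> is a component of an intersection over fewer
  indices.\<close>

lemma intersection_components_least_superset:
  assumes S: "connectedin X S" "S \<noteq> {}" and a: "a \<in> I" "S \<subseteq> N a"
  shows "\<exists>D\<in>intersection_components X N I.
    S \<subseteq> D \<and> (\<forall>E\<in>intersection_components X N I. S \<subseteq> E \<longrightarrow> D \<subseteq> E)"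
proof -
  define A where "A = {a \<in> I. S \<subseteq> N a}"
  let ?M = "\<Inter>a\<in>A. N a"
  have SM: "S \<subseteq> ?M" by (auto simp: A_def)
  then have cS: "connectedin (subtopology X ?M) S" using S by (simp add: connectedin_subtopology)
  then have "subtopology X ?M \<noteq> trivial_topology"
    using S connectedin_subset_topspace by fastforce
  then obtain D where D: "D \<in> connected_components_of (subtopology X ?M)" "S \<subseteq> D"
    using exists_connected_component_of_superset[OF cS] by blast
  have "A \<noteq> {}" "A \<subseteq> I" "?M \<noteq> {}" using a SM S by (auto simp: A_def)
  then have DI: "D \<in> intersection_components X N I"
    using D unfolding intersection_components_def by blast
  have "D \<subseteq> E" if E: "E \<in> intersection_components X N I" "S \<subseteq> E" for E
  proof -
    obtain A' where A': "A' \<subseteq> I" and E': "E \<in> connected_components_of (subtopology X (\<Inter>a\<in>A'. N a))"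
      using E by (auto simp: intersection_components_def)
    have "E \<subseteq> (\<Inter>a\<in>A'. N a)"
      using connected_components_of_subset[OF E'] by auto
    then have "A' \<subseteq> A" using E A' by (auto simp: A_def)
    then have MM: "?M \<subseteq> (\<Inter>a\<in>A'. N a)" by blast
    have "D \<subseteq> ?M" using connected_components_of_subset[OF D(1)] by auto
    then have "connectedin (subtopology X (\<Inter>a\<in>A'. N a)) D"
      using MM intersection_components_connectedin(1)[OF DI] by (auto simp: connectedin_subtopology)
    moreover have "\<not> disjnt E D" using E D S by (auto simp: disjnt_def)
    ultimately show ?thesis using connected_components_of_maximal[OF E'] by blast
  qed
  then show ?thesis using DI D by blast
qed

lemma images_have_least_supersets_intersection_components:
  assumes "\<And>f a. \<lbrakk>continuous_map X Y f; a \<in> I\<rbrakk> \<Longrightarrow> \<exists>b\<in>J. f ` N a \<subseteq> M b"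
  shows "images_have_least_supersets X (intersection_components X N I) Y (intersection_components Y M J)"
  unfolding images_have_least_supersets_def
proof (intro allI impI ballI)
  fix f C assume f: "continuous_map X Y f" and C: "C \<in> intersection_components X N I"
  obtain a where a: "a \<in> I" "C \<subseteq> N a" using intersection_components_connectedin(3)[OF C] by blast
  obtain b where b: "b \<in> J" "f ` N a \<subseteq> M b" using assms[OF f a(1)] by blast
  show "\<exists>D\<in>intersection_components Y M J. f ` C \<subseteq> D \<and>
      (\<forall>E\<in>intersection_components Y M J. f ` C \<subseteq> E \<longrightarrow> D \<subseteq> E)"
  proof (rule intersection_components_least_superset)
    show "connectedin Y (f ` C)"
      using f intersection_components_connectedin(1)[OF C] by (rule connectedin_continuous_map_image)
    show "f ` C \<noteq> {}" using intersection_components_connectedin(2)[OF C] by blast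
    show "b \<in> J" "f ` C \<subseteq> M b" using a b by blast+
  qed
qed

section \<open>Minimal open and closed sets of a finite space\<close>

lemma mem_min_open_iff: "y \<in> min_open X x \<longleftrightarrow> (\<forall>U. openin X U \<and> x \<in> U \<longrightarrow> y \<in> U)"
  by (auto simp: min_open_def)

lemma min_open_subset_iff: "min_open X x \<subseteq> min_open X y \<longleftrightarrow> x \<in> min_open X y"
  by (auto simp: mem_min_open_iff)

lemma openin_min_open:
  assumes "finite (topspace X)" "x \<in> topspace X"
  shows "openin X (min_open X x)"
  unfolding min_open_def
proof (rule openin_Inter)
  have "{U. openin X U \<and> x \<in> U} \<subseteq> Pow (topspace X)" using openin_subset by blast
  then show "finite {U. openin X U \<and> x \<in> U}" using assms finite_subset by blast
qed (use assms in auto)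

lemma min_closed_eq_closure_of:
  assumes "x \<in> topspace X"
  shows "min_closed X x = X closure_of {x}"
  using assms
  by (auto simp: min_closed_def spec_le_def min_open_subset_iff in_closure_of mem_min_open_iff)

lemma image_min_open_subset:
  assumes f: "continuous_map X Y f" and x: "x \<in> topspace X"
  shows "f ` min_open X x \<subseteq> min_open Y (f x)"
proof clarify
  fix y assume y: "y \<in> min_open X x"
  show "f y \<in> min_open Y (f x)"
    unfolding mem_min_open_iff
  proof (intro allI impI)
    fix V assume V: "openin Y V \<and> f x \<in> V"
    then have "openin X {z \<in> topspace X. f z \<in> V}"
      using f by (auto intro: openin_continuous_map_preimage)
    then show "f y \<in> V" using y x V unfolding mem_min_open_iff by blast
  qed
qed

lemma image_min_closed_subset:
  assumes f: "continuous_map X Y f" and x: "x \<in> topspace X"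
  shows "f ` min_closed X x \<subseteq> min_closed Y (f x)"
proof -
  have fx: "f x \<in> topspace Y" using f x by (auto simp: continuous_map_def Pi_iff)
  show ?thesis
    unfolding min_closed_eq_closure_of[OF x] min_closed_eq_closure_of[OF fx]
    using continuous_map_image_closure_subset[OF f, of "{x}"] by simp
qed

text \<open>This is where \<open>T\<^sub>0\<close> enters: the specialisation preorder is antisymmetric, so a point whose
  minimal open set is maximal (minimal) for inclusion is a maximal (minimal) point.\<close>

lemma min_open_inject:
  assumes "t0_space X" "x \<in> topspace X" "y \<in> topspace X" "min_open X x = min_open X y"
  shows "x = y"
proof (rule ccontr)
  assume "x \<noteq> y"
  then obtain U where U: "openin X U" "x \<notin> U \<longleftrightarrow> y \<in> U"
    using assms(1-3) unfolding t0_space_def by meson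
  have "x \<in> min_open X y" "y \<in> min_open X x"
    using assms(4) by (simp_all flip: min_open_subset_iff)
  then show False using U unfolding mem_min_open_iff by blast
qed

lemma exists_mxl_above:
  assumes X: "finite_t0_space X" and x: "x \<in> topspace X"
  obtains m where "m \<in> mxl X" "min_open X x \<subseteq> min_open X m"
proof -
  have "finite (min_open X ` topspace X)" using X by (simp add: finite_t0_space_def)
  then obtain M where M: "M \<in> min_open X ` topspace X" "min_open X x \<subseteq> M"
    and max: "\<And>M'. \<lbrakk>M' \<in> min_open X ` topspace X; M \<subseteq> M'\<rbrakk> \<Longrightarrow> M = M'"
    using finite_has_maximal2[of "min_open X ` topspace X" "min_open X x"] x by (metis imageI)
  obtain m where m: "m \<in> topspace X" "M = min_open X m" using M by blast
  have "y = m" if "y \<in> topspace X" "min_open X m \<subseteq> min_open X y" for y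
    using max[of "min_open X y"] that m X min_open_inject[of X m y]
    by (simp add: finite_t0_space_def)
  then have "m \<in> mxl X" using m by (simp add: mxl_def spec_le_def)
  then show thesis by (rule that[OF _ M(2)[unfolded m(2)]])
qed

lemma exists_mnl_below:
  assumes X: "finite_t0_space X" and x: "x \<in> topspace X"
  obtains m where "m \<in> mnl X" "min_open X m \<subseteq> min_open X x"
proof -
  have "finite (min_open X ` topspace X)" using X by (simp add: finite_t0_space_def)
  then obtain M where M: "M \<in> min_open X ` topspace X" "M \<subseteq> min_open X x"
    and min: "\<And>M'. \<lbrakk>M' \<in> min_open X ` topspace X; M' \<subseteq> M\<rbrakk> \<Longrightarrow> M = M'"
    using finite_has_minimal2[of "min_open X ` topspace X" "min_open X x"] x by (metis imageI)
  obtain m where m: "m \<in> topspace X" "M = min_open X m" using M by blast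
  have "y = m" if "y \<in> topspace X" "min_open X y \<subseteq> min_open X m" for y
    using min[of "min_open X y"] that m X min_open_inject[of X m y]
    by (simp add: finite_t0_space_def)
  then have "m \<in> mnl X" using m by (simp add: mnl_def spec_le_def)
  then show thesis by (rule that[OF _ M(2)[unfolded m(2)]])
qed

section \<open>The families of components\<close>

lemma \<U>_set_eq: "\<U>_set X = intersection_components X (min_open X) (mxl X)"
  by (simp add: \<U>_set_def intersection_components_def)

lemma \<F>_set_eq: "\<F>_set X = intersection_components X (min_closed X) (mnl X)"
  by (simp add: \<F>_set_def intersection_components_def)

text \<open>A finite space has finitely many components, so components of an open set are open.\<close>

lemma openin_\<U>_set:
  assumes X: "finite_t0_space X" and C: "C \<in> \<U>_set X"
  shows "openin X C"
proof -
  have fin: "finite (topspace X)" using X by (simp add: finite_t0_space_def)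
  obtain A where A: "A \<noteq> {}" "A \<subseteq> mxl X"
    and C: "C \<in> connected_components_of (subtopology X (\<Inter>a\<in>A. min_open X a))"
    using C by (auto simp: \<U>_set_def)
  have AX: "A \<subseteq> topspace X" using A by (auto simp: mxl_def)
  have "finite A" using fin AX finite_subset by blast
  then have "openin X (\<Inter>a\<in>A. min_open X a)"
    using A AX fin by (intro openin_Inter) (auto intro: openin_min_open)
  moreover have "openin (subtopology X (\<Inter>a\<in>A. min_open X a)) C"
  proof (rule open_in_finite_connected_components[OF _ C])
    have "connected_components_of (subtopology X (\<Inter>a\<in>A. min_open X a)) \<subseteq> Pow (topspace X)"
      using connected_components_of_subset by fastforce
    then show "finite (connected_components_of (subtopology X (\<Inter>a\<in>A. min_open X a)))"
      using fin finite_subset by blast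
  qed
  ultimately show ?thesis by (metis openin_trans_full)
qed

lemma closedin_\<F>_set:
  assumes "C \<in> \<F>_set X"
  shows "closedin X C"
proof -
  obtain A where A: "A \<noteq> {}" "A \<subseteq> mnl X"
    and C: "C \<in> connected_components_of (subtopology X (\<Inter>a\<in>A. min_closed X a))"
    using assms by (auto simp: \<F>_set_def)
  have "closedin X (\<Inter>a\<in>A. min_closed X a)"
    using A by (intro closedin_Inter) (auto simp: min_closed_eq_closure_of mnl_def)
  moreover have "closedin (subtopology X (\<Inter>a\<in>A. min_closed X a)) C"
    using C by (rule closedin_connected_components_of)
  ultimately show ?thesis by (metis closedin_trans_full)
qed

lemma images_have_least_supersets_\<U>_set:
  assumes "finite_t0_space Y"
  shows "images_have_least_supersets X (\<U>_set X) Y (\<U>_set Y)"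
  unfolding \<U>_set_eq
proof (rule images_have_least_supersets_intersection_components)
  fix f x assume f: "continuous_map X Y f" and "x \<in> mxl X"
  then have x: "x \<in> topspace X" by (simp add: mxl_def)
  have fx: "f x \<in> topspace Y" using f x by (auto simp: continuous_map_def Pi_iff)
  obtain m where m: "m \<in> mxl Y" "min_open Y (f x) \<subseteq> min_open Y m"
    by (rule exists_mxl_above[OF assms fx])
  show "\<exists>b\<in>mxl Y. f ` min_open X x \<subseteq> min_open Y b"
    using m(1) subset_trans[OF image_min_open_subset[OF f x] m(2)] by (rule bexI[rotated])
qed

lemma images_have_least_supersets_\<F>_set:
  assumes "finite_t0_space Y"
  shows "images_have_least_supersets X (\<F>_set X) Y (\<F>_set Y)"
  unfolding \<F>_set_eq
proof (rule images_have_least_supersets_intersection_components)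
  fix f x assume f: "continuous_map X Y f" and "x \<in> mnl X"
  then have x: "x \<in> topspace X" by (simp add: mnl_def)
  have fx: "f x \<in> topspace Y" using f x by (auto simp: continuous_map_def Pi_iff)
  obtain m where m: "m \<in> mnl Y" "min_open Y m \<subseteq> min_open Y (f x)"
    by (rule exists_mnl_below[OF assms fx])
  have le: "min_closed Y (f x) \<subseteq> min_closed Y m"
    using m by (auto simp: min_closed_def spec_le_def mnl_def)
  show "\<exists>b\<in>mnl Y. f ` min_closed X x \<subseteq> min_closed Y b"
    using m(1) subset_trans[OF image_min_closed_subset[OF f x] le] by (rule bexI[rotated])
qed

lemma \<U>_map_eq: "\<U>_map Y f C = least_superset (\<U>_set Y) (f ` C)"
  by (simp add: \<U>_map_def least_superset_def)

lemma \<F>_map_eq: "\<F>_map Y f C = least_superset (\<F>_set Y) (f ` C)"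
  by (simp add: \<F>_map_def least_superset_def poset_max_def poset_min_def)

lemma \<C>_space_eq: "\<C>_space X = glued_space (\<U>_set X) (\<F>_set X)"
  by (simp add: \<C>_space_def glued_space_def \<C>_le_def[abs_def] glued_le_def[abs_def])

section \<open>The three induced homotopy equivalences\<close>

theorem corollary3p24:
  fixes X :: "'a topology" and Y :: "'b topology" and f :: "'a \<Rightarrow> 'b"
  assumes "finite_t0_space X" and "finite_t0_space Y"
    and "homotopy_equivalence_map X Y f"
  shows "homotopy_equivalence_map (\<U>_space X) (\<U>_space Y) (\<U>_map Y f) \<and>
         homotopy_equivalence_map (\<F>_space X) (\<F>_space Y) (\<F>_map Y f) \<and>
         (\<U>_set X \<inter> \<F>_set X = {} \<and> \<U>_set Y \<inter> \<F>_set Y = {} \<longrightarrow>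
            homotopy_equivalence_map (\<C>_space X) (\<C>_space Y) (\<C>_map X Y f))"
proof (intro conjI impI)
  note lsU = images_have_least_supersets_\<U>_set[OF assms(2)] images_have_least_supersets_\<U>_set[OF assms(1)]
    images_have_least_supersets_\<U>_set[OF assms(1)] images_have_least_supersets_\<U>_set[OF assms(2)]
  note lsF = images_have_least_supersets_\<F>_set[OF assms(2)] images_have_least_supersets_\<F>_set[OF assms(1)]
    images_have_least_supersets_\<F>_set[OF assms(1)] images_have_least_supersets_\<F>_set[OF assms(2)]
  have empty: "images_have_least_supersets Z {} Z' K"
    for Z :: "'c topology" and Z' :: "'d topology" and K
    by (simp add: images_have_least_supersets_def)
  have fin: "finite (topspace X)" "finite (topspace Y)"
    using assms by (auto simp: finite_t0_space_def)
  have "homotopy_equivalence_map (glued_space (\<U>_set X) {}) (glued_space (\<U>_set Y) {})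
      (glued_map (\<U>_set X) (\<U>_set Y) {} f)"
    by (rule homotopy_equivalence_map_glued_map[OF _ _ lsU empty empty empty empty assms(3)])
      (use fin openin_\<U>_set assms in \<open>auto simp: open_closed_families_def\<close>)
  then show "homotopy_equivalence_map (\<U>_space X) (\<U>_space Y) (\<U>_map Y f)"
    unfolding \<U>_space_def glued_space_empty_right
    by (rule homotopy_equivalence_map_cong)
      (simp add: topspace_poset_space glued_map_def \<U>_map_eq)
  have "homotopy_equivalence_map (glued_space {} (\<F>_set X)) (glued_space {} (\<F>_set Y))
      (glued_map {} {} (\<F>_set Y) f)"
    by (rule homotopy_equivalence_map_glued_map[OF _ _ empty empty empty empty lsF assms(3)])
      (use fin closedin_\<F>_set in \<open>auto simp: open_closed_families_def\<close>)
  then show "homotopy_equivalence_map (\<F>_space X) (\<F>_space Y) (\<F>_map Y f)"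
    unfolding \<F>_space_def glued_space_empty_left
    by (rule homotopy_equivalence_map_cong) (simp add: glued_map_def \<F>_map_eq)
  assume disj: "\<U>_set X \<inter> \<F>_set X = {} \<and> \<U>_set Y \<inter> \<F>_set Y = {}"
  have "homotopy_equivalence_map (glued_space (\<U>_set X) (\<F>_set X)) (glued_space (\<U>_set Y) (\<F>_set Y))
      (glued_map (\<U>_set X) (\<U>_set Y) (\<F>_set Y) f)"
    by (rule homotopy_equivalence_map_glued_map[OF _ _ lsU lsF assms(3)])
      (use fin disj openin_\<U>_set closedin_\<F>_set assms in \<open>auto simp: open_closed_families_def\<close>)
  then show "homotopy_equivalence_map (\<C>_space X) (\<C>_space Y) (\<C>_map X Y f)"
    unfolding \<C>_space_eq
    by (rule homotopy_equivalence_map_cong)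
      (simp add: glued_map_def \<C>_map_def \<U>_map_eq \<F>_map_eq)
qed

end
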